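(* Let $D$ be an oriented knot diagram on $S^2$, let $c(D)$ be the crossing number of $D$, and let $\overline{M}(D)$ be the warping matrix of $D$ without signs. Then $$\mathrm{rank}\, \overline{M}(D)=c(D)+1.$$
   Context: An oriented knot projection $P$ on $S^2$ is a generic immersion of an oriented circle in $S^2$ (its only singularities are finitely many transverse double points, called crossings). An oriented knot diagram $D$ on $S^2$ is an oriented knot projection with over/under information at each crossing; the crossing number $c(D)$ is the number of crossings of $D$. For a base point $b$ of $D$ avoiding crossings, a crossing $p$ is a warping crossing point of $D_b=(D,b)$ if, when traveling along $D$ from $b$ following the orientation, one meets $p$ first as an undercrossing. The warping degree $d(D_b)$ is the number of warping crossing points of $D_b$. Let $P$ be an oriented knot projection with $c$ crossings. An edge of $P$ is a part of $P$ between two crossings which has no crossings in its interior. Take one base point on each edge of $P$ and label them $b_1,\dots,b_{2c}$ in order of traversal, starting from some edge. Giving over/under information at each crossing of $P$ in all possible ways yields $2^c$ knot diagrams $D^1,\dots,D^{2^c}$. The warping matrix $M(P)$ is the $2^c\times 2c$ matrix whose $(i,j)$ entry is $d(D^i_{b_j})$, considered up to permutations of rows and cyclic permutations of columns. For an oriented knot diagram $D$ with $c$ crossings, let $P$ be the knot projection obtained from $D$ by ignoring the over/under information. The warping matrix without signs $\overline{M}(D)$ is the $(2^c-1)\times 2c$ matrix obtained from $M(P)$ by deleting the row corresponding to $D$. Rank is the usual rank of a matrix.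
   Formalization: The formal theorem assumes c(D) ≥ 2, since the claim fails for fewer crossings: with c(D)=1 the matrix without signs is 1×2, so its rank is at most 1 rather than 2, and with c(D)=0 it is an empty matrix of rank 0 rather than 1. *)

theory Defs
  imports "HOL-Analysis.Analysis" "Jordan_Normal_Form.DL_Rank" "Jordan_Normal_Form.DL_Submatrix"
begin

text \<open>
  The oriented circle is \<open>\<real>/\<int>\<close>, oriented by increasing parameter. A closed curve is a 1-periodic
  function on the reals, and each point of the circle has a unique parameter in \<open>{0..<1}\<close>.
\<close>

definition smooth_curve :: "(real \<Rightarrow> 'a::real_normed_vector) \<Rightarrow> bool" where
  "smooth_curve \<gamma> \<longleftrightarrow>
     (\<exists>F :: nat \<Rightarrow> real \<Rightarrow> 'a. F 0 = \<gamma> \<and>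
        (\<forall>n t. (F n has_vector_derivative F (Suc n) t) (at t)))"

definition immersed_circle :: "(real \<Rightarrow> real^3) \<Rightarrow> bool" where
  "immersed_circle \<gamma> \<longleftrightarrow>
     smooth_curve \<gamma> \<and> (\<forall>t. \<gamma> (t + 1) = \<gamma> t) \<and> (\<forall>t. \<gamma> t \<in> sphere 0 1) \<and>
     (\<forall>t. vector_derivative \<gamma> (at t) \<noteq> 0)"

definition preimages :: "(real \<Rightarrow> real^3) \<Rightarrow> real^3 \<Rightarrow> real set" where
  "preimages \<gamma> x = {t \<in> {0..<1}. \<gamma> t = x}"

definition crossings :: "(real \<Rightarrow> real^3) \<Rightarrow> (real^3) set" where
  "crossings \<gamma> = {x. \<exists>s \<in> preimages \<gamma> x. \<exists>t \<in> preimages \<gamma> x. s \<noteq> t}"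

text \<open>
  Transversality: the two tangent lines at a double point \<open>x\<close> span the tangent plane of the unit
  sphere at \<open>x\<close>, which is the orthogonal complement of \<open>x\<close>.
\<close>

definition knot_projection :: "(real \<Rightarrow> real^3) \<Rightarrow> bool" where
  "knot_projection \<gamma> \<longleftrightarrow>
     immersed_circle \<gamma> \<and> finite (crossings \<gamma>) \<and>
     (\<forall>x \<in> crossings \<gamma>. card (preimages \<gamma> x) = 2) \<and>
     (\<forall>x \<in> crossings \<gamma>. \<forall>s \<in> preimages \<gamma> x. \<forall>t \<in> preimages \<gamma> x. s \<noteq> t \<longrightarrow>
        span {vector_derivative \<gamma> (at s), vector_derivative \<gamma> (at t)} = {v. inner v x = 0})"

text \<open>
  The over/under information assigns to each crossing the parameter in \<open>{0..<1}\<close> at which the over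
  strand passes through it. It is required to be \<open>undefined\<close> away from the crossings (\<open>\<Pi>\<^sub>E\<close>), so
  that diagrams with the same over/under information are equal as records.
\<close>

record diagram =
  proj :: "real \<Rightarrow> real^3"
  over :: "real^3 \<Rightarrow> real"

definition knot_diagram :: "diagram \<Rightarrow> bool" where
  "knot_diagram D \<longleftrightarrow>
     knot_projection (proj D) \<and> over D \<in> (\<Pi>\<^sub>E x \<in> crossings (proj D). preimages (proj D) x)"

definition crossing_number :: "diagram \<Rightarrow> nat" where
  "crossing_number D = card (crossings (proj D))"

definition diagrams_over :: "(real \<Rightarrow> real^3) \<Rightarrow> diagram set" where
  "diagrams_over \<gamma> = {D. knot_diagram D \<and> proj D = \<gamma>}"

text \<open>
  Base points are given by real parameters. The parameter \<open>t\<close> below is that of the first visit to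
  \<open>x\<close> after the base point \<open>b\<close>; its representative in \<open>{0..<1}\<close> is \<open>frac t\<close>.
\<close>

definition warping_crossing :: "diagram \<Rightarrow> real \<Rightarrow> real^3 \<Rightarrow> bool" where
  "warping_crossing D b x \<longleftrightarrow>
     x \<in> crossings (proj D) \<and>
     (\<exists>t\<ge>b. proj D t = x \<and> (\<forall>s. b \<le> s \<and> s < t \<longrightarrow> proj D s \<noteq> x) \<and> frac t \<noteq> over D x)"

definition warping_degree :: "diagram \<Rightarrow> real \<Rightarrow> nat" where
  "warping_degree D b = card {x. warping_crossing D b x}"

text \<open>Edges are taken without their end points.\<close>

definition edges :: "(real \<Rightarrow> real^3) \<Rightarrow> (real^3) set set" where
  "edges \<gamma> = {\<gamma> ` {s<..<t} | s t. s < t \<and> \<gamma> s \<in> crossings \<gamma> \<and> \<gamma> t \<in> crossings \<gamma> \<and>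
                \<gamma> ` {s<..<t} \<inter> crossings \<gamma> = {}}"

text \<open>
  One base point on each edge, listed in order of traversal within one turn of the circle. The
  starting edge is arbitrary, since the parameters need not lie in \<open>{0..<1}\<close>.
\<close>

definition edge_base_points :: "(real \<Rightarrow> real^3) \<Rightarrow> real list \<Rightarrow> bool" where
  "edge_base_points \<gamma> bs \<longleftrightarrow>
     length bs = 2 * card (crossings \<gamma>) \<and> sorted_wrt (<) bs \<and>
     (\<forall>b \<in> set bs. \<forall>b' \<in> set bs. b' < b + 1) \<and>
     (\<forall>b \<in> set bs. \<gamma> b \<notin> crossings \<gamma>) \<and>
     (\<forall>e \<in> edges \<gamma>. \<exists>!b. b \<in> set bs \<and> \<gamma> b \<in> e)"

definition warping_matrix :: "diagram list \<Rightarrow> real list \<Rightarrow> real mat" where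
  "warping_matrix Ds bs =
     mat (length Ds) (length bs) (\<lambda>(i, j). real (warping_degree (Ds ! i) (bs ! j)))"

definition warping_matrix_without_signs ::
    "diagram \<Rightarrow> diagram list \<Rightarrow> real list \<Rightarrow> real mat" where
  "warping_matrix_without_signs D Ds bs =
     submatrix (warping_matrix Ds bs) {i. i < length Ds \<and> Ds ! i \<noteq> D} UNIV"

definition matrix_rank :: "real mat \<Rightarrow> nat" where
  "matrix_rank A = vec_space.rank (dim_row A) A"

end

theory Submission
  imports Defs
begin

text \<open>
  For a crossing \<open>x\<close> let \<open>g x\<close> be the \<open>\<plusminus>1\<close> vector telling which diagrams agree with \<open>D\<close> at \<open>x\<close>, and
  let \<open>h x\<close> be the \<open>\<plusminus>1\<close> function on base points telling whether the strand met first at \<open>x\<close> is the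
  over strand of \<open>D\<close>. The column of the base point \<open>b\<close> is \<open>c/2 - 1/2 \<Sum>x. h x b \<cdot> g x\<close>. Base points just
  before and just after a pass through \<open>x\<close> have columns differing by \<open>\<plusminus>g x\<close>, so the column space is
  spanned by the \<open>g x\<close> and the constant vector \<open>1\<close>. These \<open>c + 1\<close> vectors remain independent after the
  row of \<open>D\<close> is deleted: as \<open>c \<ge> 2\<close>, there are still two diagrams differing only at \<open>x\<close>.
\<close>

section \<open>Linear algebra: column spans and the rank of matrices of symmetric
  differences\<close>

lemma (in vec_space) vec_sum_in_span:
  assumes W: "W \<subseteq> carrier_vec n" and "finite X"
    and f: "\<And>x. x \<in> X \<Longrightarrow> vec n (f x) \<in> span W"
  shows "vec n (\<lambda>i. \<Sum>x\<in>X. a x * f x i) \<in> span W"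
  using \<open>finite X\<close> f
proof (induction X rule: finite_induct)
  case empty
  have "vec n (\<lambda>i. 0 :: 'a) = 0\<^sub>v n" by auto
  then show ?case using span_is_submodule[of W] W unfolding submodule_def by simp
next
  case (insert x X)
  have "vec n (\<lambda>i. \<Sum>x\<in>insert x X. a x * f x i)
      = a x \<cdot>\<^sub>v vec n (f x) + vec n (\<lambda>i. \<Sum>x\<in>X. a x * f x i)"
    using insert.hyps by (intro eq_vecI) auto
  moreover have "a x \<cdot>\<^sub>v vec n (f x) \<in> span W"
    by (rule smult_in_span[OF W insert.prems]) simp
  moreover have "vec n (\<lambda>i. \<Sum>x\<in>X. a x * f x i) \<in> span W"
    using insert by auto
  ultimately show ?case using span_add1[of W] W by simp
qed

text \<open>The columns and the family span each other, so the family is a basis of the column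
  space. Independence is assumed for coefficients on the index set, entry by entry, which also rules
  out repeated vectors; hence \<open>card I\<close> counts the basis.\<close>

lemma (in vec_space) rank_eq_card_family:
  assumes A: "A \<in> carrier_mat n nc" and fin: "finite I"
    and indep: "\<And>a k. (\<And>i. i < n \<Longrightarrow> (\<Sum>k\<in>I. a k * f k i) = 0) \<Longrightarrow> k \<in> I \<Longrightarrow> a k = 0"
    and cols: "set (cols A) \<subseteq> span ((\<lambda>k. vec n (f k)) ` I)"
    and fam: "(\<lambda>k. vec n (f k)) ` I \<subseteq> span (set (cols A))"
  shows "rank A = card I"
proof -
  define v where "v k = vec n (f k)" for k
  have vI: "v ` I \<subseteq> carrier_vec n" by (auto simp: v_def)
  have cA: "set (cols A) \<subseteq> carrier_vec n" using A cols_dim by blast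
  have inj: "inj_on v I"
  proof (rule inj_onI, rule ccontr)
    fix k l assume kl: "k \<in> I" "l \<in> I" "v k = v l" "k \<noteq> l"
    \<comment> \<open>If indices \<open>k\<close> and \<open>l\<close> gave the same vector, the
      coefficients 1 and -1 there would be a nontrivial relation.\<close>
    define a where "a m = (if m = k then 1 else if m = l then - 1 else 0 :: 'a)" for m
    have "(\<Sum>m\<in>I. a m * f m i) = 0" if "i < n" for i
    proof -
      have "(\<Sum>m\<in>I. a m * f m i) = (\<Sum>m\<in>{k, l}. a m * f m i)"
        using fin kl by (intro sum.mono_neutral_right) (auto simp: a_def)
      also have "\<dots> = f k i - f l i" using kl by (simp add: a_def)
      also have "\<dots> = 0" using arg_cong[OF kl(3), of "\<lambda>w. w $ i"] that by (simp add: v_def)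
      finally show ?thesis .
    qed
    from indep[of a k, OF this] kl show False by (simp add: a_def)
  qed
  have zero: "\<forall>w\<in>v ` I. a w = 0" if 0: "lincomb a (v ` I) = 0\<^sub>v n" for a
  proof -
    have "(\<Sum>k\<in>I. a (v k) * f k i) = 0" if "i < n" for i
    proof -
      have "lincomb a (v ` I) $ i = (\<Sum>k\<in>I. a (v k) * f k i)"
        unfolding lincomb_index[OF that vI] sum.reindex[OF inj] using that by (simp add: v_def)
      then show ?thesis using 0 that by simp
    qed
    from indep[of "\<lambda>k. a (v k)", OF this]
    show ?thesis by auto
  qed
  have li: "lin_indpt (v ` I)"
    by (rule finite_lin_indpt2) (use fin vI zero in auto)
  have "span (set (cols A)) = span (v ` I)"
    using span_subsetI[OF vI] span_subsetI[OF cA] cols fam unfolding v_def by blast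
  then have "rank A = vectorspace.dim class_ring (span_vs (v ` I))"
    by (simp add: rank_def)
  also have "\<dots> = card (v ` I)"
    using li fin vI by (intro dim_span) (auto simp: maximal_def)
  also have "\<dots> = card I" using inj by (rule card_image)
  finally show ?thesis .
qed

text \<open>The combinatorial core, free of curves. In the application \<open>S i\<close> holds the
  crossings at which the i-th remaining diagram differs from \<open>D\<close>, and
  \<open>T j\<close> the crossings that are warping for \<open>D\<close> at the j-th base point.
  Only nonempty \<open>Y\<close> are required as rows, because \<open>Y = {}\<close> corresponds to
  \<open>D\<close> itself.\<close>

lemma rank_symmetric_difference_matrix:
  fixes A :: "real mat" and S T :: "nat \<Rightarrow> 'a set"
  assumes A: "A \<in> carrier_mat m n" and X: "finite X" "card X \<ge> 2"
    and entry: "\<And>i j. i < m \<Longrightarrow> j < n \<Longrightarrow>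
      A $$ (i, j) = real (card {x \<in> X. (x \<in> S i) \<noteq> (x \<in> T j)})"
    and rows: "\<And>Y. Y \<subseteq> X \<Longrightarrow> Y \<noteq> {} \<Longrightarrow> \<exists>i<m. S i \<inter> X = Y"
    and separate: "\<And>x. x \<in> X \<Longrightarrow> \<exists>j<n. \<exists>j'<n. x \<in> T j \<and> x \<notin> T j' \<and>
      (\<forall>y\<in>X. y \<noteq> x \<longrightarrow> (y \<in> T j \<longleftrightarrow> y \<in> T j'))"
  shows "vec_space.rank m A = card X + 1"
proof -
  interpret vec_space "TYPE(real)" m .
  define g where "g x i = (if x \<in> S i then - 1 else 1 :: real)" for x i
  define h where "h x j = (if x \<in> T j then - 1 else 1 :: real)" for x j
  \<comment> \<open>\<open>None\<close> indexes the constant vector and \<open>Some x\<close> the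
    sign vector of \<open>x\<close>, so the index set has \<open>card X + 1\<close>
    elements.\<close>
  define f where "f k = (case k of None \<Rightarrow> (\<lambda>i. 1) | Some x \<Rightarrow> g x)" for k
  define I where "I = insert None (Some ` X)"
  have finI: "finite I" using X by (simp add: I_def)
  have cardI: "card I = card X + 1"
    using X by (simp add: I_def card_image)
  have sumI: "(\<Sum>k\<in>I. a k * f k i) = a None + (\<Sum>x\<in>X. a (Some x) * g x i)" for a i
    using X by (simp add: I_def f_def sum.reindex)
  \<comment> \<open>For signs, the indicator of \<open>g \<noteq> h\<close> is (1 - g h)/2; summing
    over \<open>X\<close> gives the formula.\<close>
  have entry': "A $$ (i, j) = card X / 2 + (\<Sum>x\<in>X. (- h x j / 2) * g x i)"
    if "i < m" "j < n" for i j
  proof -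
    have "A $$ (i, j) = (\<Sum>x\<in>X. if (x \<in> S i) \<noteq> (x \<in> T j) then 1 else 0)"
      using X entry[OF that] by (simp add: sum.If_cases Int_def)
    also have "\<dots> = (\<Sum>x\<in>X. 1 / 2 + (- h x j / 2) * g x i)"
      by (intro sum.cong) (auto simp: g_def h_def)
    finally show ?thesis by (simp only: sum.distrib) simp
  qed
  have cA: "set (cols A) \<subseteq> carrier_vec m" using A cols_dim by blast
  let ?W = "span (set (cols A))"
  have col_in: "col A j \<in> ?W" if "j < n" for j
    using that A cA by (intro span_mem) (auto simp: cols_def)
  have gW: "vec m (g x) \<in> ?W" if x: "x \<in> X" for x
  proof -
    from separate[OF x] obtain j j' where j: "j < n" "j' < n" "x \<in> T j" "x \<notin> T j'"
      and eq: "\<forall>y\<in>X. y \<noteq> x \<longrightarrow> (y \<in> T j \<longleftrightarrow> y \<in> T j')" by blast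
    \<comment> \<open>In the difference of the two columns only the term of \<open>x\<close>
      survives; there \<open>h\<close> is -1 at \<open>j\<close> and 1 at \<open>j'\<close>, so the
      two halves add up to \<open>g x\<close>.\<close>
    have "vec m (g x) = col A j + (- 1) \<cdot>\<^sub>v col A j'"
    proof (intro eq_vecI)
      fix i assume "i < dim_vec (col A j + (- 1) \<cdot>\<^sub>v col A j')"
      then have i: "i < m" using A by simp
      have "A $$ (i, j) - A $$ (i, j')
          = (\<Sum>y\<in>X. (- h y j / 2) * g y i - (- h y j' / 2) * g y i)"
        using i j by (simp add: entry' sum_subtractf sum_negf)
      also have "\<dots> = (\<Sum>y\<in>{x}. (- h y j / 2) * g y i - (- h y j' / 2) * g y i)"
        using x X eq by (intro sum.mono_neutral_right) (auto simp: h_def)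
      also have "\<dots> = g x i" using j by (simp add: h_def)
      finally show "vec m (g x) $ i = (col A j + (- 1) \<cdot>\<^sub>v col A j') $ i"
        using i j A by simp
    qed (use A in auto)
    then show ?thesis
      using span_add1[of "set (cols A)", OF _ col_in[OF j(1)] smult_in_span[OF cA col_in[OF j(2)]]] cA
      by simp
  qed
  have oneW: "vec m (\<lambda>i. 1) \<in> ?W"
  proof -
    obtain x where "x \<in> X" using X by fastforce
    from separate[OF this] obtain j where j: "j < n" by blast
    have s: "vec m (\<lambda>i. \<Sum>x\<in>X. (h x j / 2) * g x i) \<in> ?W"
      using cA X gW by (intro vec_sum_in_span) auto
    \<comment> \<open>This is \<open>entry'\<close> solved for the constant vector;
      \<open>card X\<close> is nonzero.\<close>
    have "vec m (\<lambda>i. 1) = (2 / card X) \<cdot>\<^sub>v (col A j + vec m (\<lambda>i. \<Sum>x\<in>X. (h x j / 2) * g x i))"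
      using A j X by (intro eq_vecI) (auto simp: entry' sum_negf field_simps)
    then show ?thesis
      using smult_in_span[OF cA span_add1[of "set (cols A)", OF _ col_in[OF j] s]] cA by simp
  qed
  have "rank A = card I"
  proof (rule rank_eq_card_family[OF A finI])
    fix a k
    assume *: "\<And>i. i < m \<Longrightarrow> (\<Sum>k\<in>I. a k * f k i) = 0" and k: "k \<in> I"
    have Some0: "a (Some x) = 0" if x: "x \<in> X" for x
    proof -
      \<comment> \<open>Comparing the rows of \<open>{}\<close> and \<open>{x}\<close> would isolate
        \<open>x\<close>, but the row of \<open>{}\<close> may be missing. A second element
        \<open>y\<close> is therefore added to both sets: the relations in the rows of
        \<open>{y}\<close> and \<open>{x, y}\<close> differ by twice the coefficient of
        \<open>x\<close>.\<close>
      have "card (X - {x}) \<noteq> 0" using X x by simp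
      then have "X - {x} \<noteq> {}" by force
      then obtain y where y: "y \<in> X" "y \<noteq> x" by blast
      obtain i where i: "i < m" "S i \<inter> X = {y}" using rows[of "{y}"] y by auto
      obtain i' where i': "i' < m" "S i' \<inter> X = {x, y}" using rows[of "{x, y}"] x y by auto
      have "0 = (\<Sum>z\<in>X. a (Some z) * g z i - a (Some z) * g z i')"
        using *[OF i(1)] *[OF i'(1)] by (simp add: sumI sum_subtractf)
      also have "\<dots> = (\<Sum>z\<in>{x}. a (Some z) * g z i - a (Some z) * g z i')"
      proof (intro sum.mono_neutral_right)
        show "\<forall>z\<in>X - {x}. a (Some z) * g z i - a (Some z) * g z i' = 0"
        proof
          fix z assume "z \<in> X - {x}"
          then have "z \<in> S i \<longleftrightarrow> z \<in> S i'" using i i' by blast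
          then show "a (Some z) * g z i - a (Some z) * g z i' = 0" by (simp add: g_def)
        qed
      qed (use x X in auto)
      also have "\<dots> = 2 * a (Some x)"
      proof -
        have "x \<notin> S i" using x y i by auto
        moreover have "x \<in> S i'" using i' by blast
        ultimately show ?thesis by (simp add: g_def)
      qed
      finally show ?thesis by simp
    qed
    have "X \<noteq> {}" using X by auto
    then obtain i where "i < m" using rows[of X] by auto
    from *[OF this] Some0 have "a None = 0" by (simp add: sumI)
    with Some0 k show "a k = 0" by (auto simp: I_def)
  next
    show "(\<lambda>k. vec m (f k)) ` I \<subseteq> ?W"
      using gW oneW by (auto simp: I_def f_def)
  next
    show "set (cols A) \<subseteq> span ((\<lambda>k. vec m (f k)) ` I)"
    proof
      fix v assume "v \<in> set (cols A)"
      then obtain j where j: "j < n" "v = col A j"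
        using A by (metis carrier_matD(2) cols_length cols_nth in_set_conv_nth)
      define a where "a k = (case k of None \<Rightarrow> card X / 2 | Some x \<Rightarrow> - h x j / 2)" for k
      have "v = vec m (\<lambda>i. \<Sum>k\<in>I. a k * f k i)"
        using j A by (intro eq_vecI) (auto simp: sumI entry' a_def)
      also have "\<dots> \<in> span ((\<lambda>k. vec m (f k)) ` I)"
        using finI by (intro vec_sum_in_span) (auto intro!: span_mem)
      finally show "v \<in> span ((\<lambda>k. vec m (f k)) ` I)" .
    qed
  qed
  then show ?thesis using cardI by simp
qed

section \<open>Parameters of the curve modulo 1\<close>

lemma curve_frac:
  assumes "immersed_circle \<gamma>"
  shows "\<gamma> (t + of_int k) = \<gamma> t" and "\<gamma> (frac t) = \<gamma> t"
proof -
  have step: "\<gamma> (t + 1) = \<gamma> t" for t using assms by (auto simp: immersed_circle_def)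
  show shift: "\<gamma> (t + of_int k) = \<gamma> t" for t k
  proof (induction k rule: int_induct[where k = 0])
    case (step1 i)
    then show ?case using step[of "t + of_int i"] by (simp add: algebra_simps)
  next
    case (step2 i)
    then show ?case using step[of "t + of_int (i - 1)"] by (simp add: algebra_simps)
  qed simp
  show "\<gamma> (frac t) = \<gamma> t"
    using shift[of "frac t" "\<lfloor>t\<rfloor>"] by (simp add: frac_def)
qed

lemma frac_in_preimages:
  assumes "immersed_circle \<gamma>" and "\<gamma> t = x"
  shows "frac t \<in> preimages \<gamma> x"
  using assms curve_frac(2)[of \<gamma> t] by (auto simp: preimages_def frac_lt_1)

text \<open>Distinct representatives in \<open>{0..<1}\<close> would make the point a crossing. This
  recovers the parameter of a base point from its position on an edge, up to an integer.\<close>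

lemma frac_eq_if_not_crossing:
  assumes "immersed_circle \<gamma>" and "\<gamma> s = \<gamma> t" and "\<gamma> s \<notin> crossings \<gamma>"
  shows "frac s = frac t"
proof (rule ccontr)
  assume "frac s \<noteq> frac t"
  moreover have "frac s \<in> preimages \<gamma> (\<gamma> s)" "frac t \<in> preimages \<gamma> (\<gamma> s)"
    by (rule frac_in_preimages[OF assms(1)], simp add: assms(2))+
  ultimately show False using assms(3) unfolding crossings_def by blast
qed

text \<open>Each of the finitely many crossings has two parameters per period, and a bounded
  interval meets finitely many periods. This allows minima and maxima to be taken below.\<close>

lemma finite_crossing_parameters:
  assumes "knot_projection \<gamma>"
  shows "finite {t \<in> {a..b}. \<gamma> t \<in> crossings \<gamma>}"
proof -
  have imm: "immersed_circle \<gamma>" and fin: "finite (crossings \<gamma>)"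
    and two: "\<And>x. x \<in> crossings \<gamma> \<Longrightarrow> card (preimages \<gamma> x) = 2"
    using assms by (auto simp: knot_projection_def)
  let ?P = "\<Union>x\<in>crossings \<gamma>. preimages \<gamma> x"
  have "finite (preimages \<gamma> x)" if "x \<in> crossings \<gamma>" for x
    using two[OF that] by (intro card_ge_0_finite) simp
  then have "finite ((\<lambda>(p, k). p + of_int k) ` (?P \<times> {\<lfloor>a\<rfloor>..\<lfloor>b\<rfloor>}))"
    using fin by auto
  moreover have "{t \<in> {a..b}. \<gamma> t \<in> crossings \<gamma>}
      \<subseteq> (\<lambda>(p, k). p + of_int k) ` (?P \<times> {\<lfloor>a\<rfloor>..\<lfloor>b\<rfloor>})"
  proof
    fix t assume t: "t \<in> {t \<in> {a..b}. \<gamma> t \<in> crossings \<gamma>}"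
    then have "frac t \<in> ?P" using frac_in_preimages[OF imm] by blast
    moreover have "\<lfloor>t\<rfloor> \<in> {\<lfloor>a\<rfloor>..\<lfloor>b\<rfloor>}" using t by (auto intro: floor_mono)
    moreover have "t = (\<lambda>(p, k). p + of_int k) (frac t, \<lfloor>t\<rfloor>)" by (simp add: frac_def)
    ultimately show "t \<in> (\<lambda>(p, k). p + of_int k) ` (?P \<times> {\<lfloor>a\<rfloor>..\<lfloor>b\<rfloor>})" by blast
  qed
  ultimately show ?thesis by (rule finite_subset[rotated])
qed

section \<open>First visits to crossings from a base point\<close>

definition first_visit :: "(real \<Rightarrow> real^3) \<Rightarrow> real \<Rightarrow> real^3 \<Rightarrow> real \<Rightarrow> bool" where
  "first_visit \<gamma> b x t \<longleftrightarrow> b \<le> t \<and> \<gamma> t = x \<and> (\<forall>s. b \<le> s \<and> s < t \<longrightarrow> \<gamma> s \<noteq> x)"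

lemma first_visit_unique: "first_visit \<gamma> b x s \<Longrightarrow> first_visit \<gamma> b x t \<Longrightarrow> s = t"
  by (cases s t rule: linorder_cases) (auto simp: first_visit_def)

lemma first_visit_exists:
  assumes "knot_projection \<gamma>" and x: "x \<in> crossings \<gamma>"
  obtains t where "first_visit \<gamma> b x t"
proof -
  have imm: "immersed_circle \<gamma>" using assms by (auto simp: knot_projection_def)
  obtain s where s: "\<gamma> s = x" using x by (auto simp: crossings_def preimages_def)
  \<comment> \<open>The least integer translate of \<open>s\<close> that is at least
    \<open>b\<close>; it bounds the search for the first visit.\<close>
  define u where "u = s + of_int \<lceil>b - s\<rceil>"
  have u: "b \<le> u" "\<gamma> u = x" unfolding u_def using s curve_frac(1)[OF imm] by (auto, linarith)
  let ?V = "{t \<in> {b..u}. \<gamma> t = x}"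
  have "?V \<subseteq> {t \<in> {b..u}. \<gamma> t \<in> crossings \<gamma>}" using x by auto
  then have fin: "finite ?V" using finite_crossing_parameters[OF assms(1)] finite_subset by blast
  have ne: "?V \<noteq> {}" using u by auto
  have "first_visit \<gamma> b x (Min ?V)"
    unfolding first_visit_def
  proof (intro conjI allI impI notI)
    show "b \<le> Min ?V" "\<gamma> (Min ?V) = x" using Min_in[OF fin ne] by auto
  next
    fix s assume s: "b \<le> s \<and> s < Min ?V" "\<gamma> s = x"
    moreover have "Min ?V \<le> u" using Min_in[OF fin ne] by auto
    ultimately have "s \<in> ?V" by auto
    then show False using Min_le[OF fin] s by fastforce
  qed
  then show thesis by (rule that)
qed

lemma first_visit_shift:
  assumes "immersed_circle \<gamma>" and "first_visit \<gamma> b x t"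
  shows "first_visit \<gamma> (b + of_int k) x (t + of_int k)"
  unfolding first_visit_def
proof (intro conjI allI impI)
  show "b + of_int k \<le> t + of_int k" "\<gamma> (t + of_int k) = x"
    using assms curve_frac(1) by (auto simp: first_visit_def)
next
  fix s assume "b + of_int k \<le> s \<and> s < t + of_int k"
  then have "b \<le> s - of_int k" "s - of_int k < t" by auto
  then have "\<gamma> (s - of_int k) \<noteq> x" using assms by (auto simp: first_visit_def)
  then show "\<gamma> s \<noteq> x" using curve_frac(1)[OF assms(1), of "s - of_int k" k] by simp
qed

text \<open>Reduced modulo 1 to be comparable with \<open>over D x\<close>. At a crossing, existence
  and uniqueness of the first visit make \<open>THE\<close> meaningful.\<close>

definition entry_parameter :: "(real \<Rightarrow> real^3) \<Rightarrow> real \<Rightarrow> real^3 \<Rightarrow> real" where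
  "entry_parameter \<gamma> b x = frac (THE t. first_visit \<gamma> b x t)"

lemma entry_parameterI: "first_visit \<gamma> b x t \<Longrightarrow> entry_parameter \<gamma> b x = frac t"
  unfolding entry_parameter_def
  by (subst the_equality[of _ t]) (auto intro: first_visit_unique)

lemma entry_parameter_in_preimages:
  assumes "knot_projection \<gamma>" and "x \<in> crossings \<gamma>"
  shows "entry_parameter \<gamma> b x \<in> preimages \<gamma> x"
proof -
  obtain t where t: "first_visit \<gamma> b x t" using assms by (rule first_visit_exists)
  then show ?thesis
    using assms frac_in_preimages[of \<gamma> t x] entry_parameterI[OF t]
    by (auto simp: first_visit_def knot_projection_def)
qed

text \<open>First visits move along with integer translations of the base point. This matters
  because the base point found on an edge may lie in a different period from the part of the line
  under study.\<close>

lemma entry_parameter_frac: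
  assumes "knot_projection \<gamma>" and "x \<in> crossings \<gamma>" and "frac b = frac b'"
  shows "entry_parameter \<gamma> b x = entry_parameter \<gamma> b' x"
proof -
  have imm: "immersed_circle \<gamma>" using assms by (auto simp: knot_projection_def)
  obtain t where t: "first_visit \<gamma> b x t" using assms by (meson first_visit_exists)
  define k where "k = \<lfloor>b'\<rfloor> - \<lfloor>b\<rfloor>"
  have b': "b' = b + of_int k" using assms(3) by (simp add: frac_def k_def algebra_simps)
  have "first_visit \<gamma> b' x (t + of_int k)"
    using first_visit_shift[OF imm t] b' by simp
  then have "entry_parameter \<gamma> b' x = frac (t + of_int k)" by (rule entry_parameterI)
  then show ?thesis using entry_parameterI[OF t] by (simp add: frac_def)
qed

lemma warping_crossing_iff:
  assumes "knot_projection (proj D)"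
  shows "warping_crossing D b x \<longleftrightarrow>
    x \<in> crossings (proj D) \<and> entry_parameter (proj D) b x \<noteq> over D x"
proof (cases "x \<in> crossings (proj D)")
  case True
  then obtain t where t: "first_visit (proj D) b x t" using assms by (meson first_visit_exists)
  have "warping_crossing D b x \<longleftrightarrow> (\<exists>t. first_visit (proj D) b x t \<and> frac t \<noteq> over D x)"
    using True by (auto simp: warping_crossing_def first_visit_def)
  also have "\<dots> \<longleftrightarrow> frac t \<noteq> over D x" using t first_visit_unique by blast
  finally show ?thesis using True entry_parameterI[OF t] by simp
qed (simp add: warping_crossing_def)

text \<open>Base points on the two edges adjacent to a pass through \<open>x\<close> see all other crossings alike.\<close>

lemma base_points_separating:
  assumes P: "knot_projection \<gamma>" and bs: "edge_base_points \<gamma> bs" and x: "x \<in> crossings \<gamma>"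
  obtains b b' where "b \<in> set bs" "b' \<in> set bs"
    "entry_parameter \<gamma> b x \<noteq> entry_parameter \<gamma> b' x"
    "\<And>y. y \<in> crossings \<gamma> \<Longrightarrow> y \<noteq> x \<Longrightarrow> entry_parameter \<gamma> b y = entry_parameter \<gamma> b' y"
proof -
  have imm: "immersed_circle \<gamma>" using P by (auto simp: knot_projection_def)
  \<comment> \<open>Two consecutive crossing parameters bound an edge, which carries a base point;
    its own parameter lies between them only modulo 1.\<close>
  have base: "\<exists>b\<in>set bs. \<exists>t. p < t \<and> t < q \<and> frac b = frac t"
    if pq: "p < q" "\<gamma> p \<in> crossings \<gamma>" "\<gamma> q \<in> crossings \<gamma>"
      "\<And>t. p < t \<Longrightarrow> t < q \<Longrightarrow> \<gamma> t \<notin> crossings \<gamma>" for p q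
  proof -
    have "\<gamma> ` {p<..<q} \<in> edges \<gamma>" using pq unfolding edges_def by fastforce
    then obtain b where b: "b \<in> set bs" "\<gamma> b \<in> \<gamma> ` {p<..<q}" "\<gamma> b \<notin> crossings \<gamma>"
      using bs unfolding edge_base_points_def by meson
    then obtain t where "p < t" "t < q" "\<gamma> b = \<gamma> t" by auto
    with b frac_eq_if_not_crossing[OF imm] show ?thesis by blast
  qed
  obtain s s' where s: "s \<in> preimages \<gamma> x" "s' \<in> preimages \<gamma> x" "s \<noteq> s'"
    using x by (auto simp: crossings_def)
  have \<gamma>s: "\<gamma> s = x" "\<gamma> (s + 1) = x" "\<gamma> (s - 1) = x"
    using s curve_frac(1)[OF imm, of s 1] curve_frac(1)[OF imm, of s "- 1"]
    by (auto simp: preimages_def)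
  \<comment> \<open>Windows of length one suffice: \<open>s - 1\<close> and \<open>s + 1\<close> are
    parameters of \<open>x\<close> itself. The maximum \<open>p\<close> and the minimum
    \<open>q\<close> are the crossing parameters next to \<open>s\<close>.\<close>
  let ?L = "{t \<in> {s - 1..<s}. \<gamma> t \<in> crossings \<gamma>}"
  let ?R = "{t \<in> {s<..s + 1}. \<gamma> t \<in> crossings \<gamma>}"
  have finL: "finite ?L"
    by (rule finite_subset[OF _ finite_crossing_parameters[OF P, of "s - 1" s]]) auto
  have finR: "finite ?R"
    by (rule finite_subset[OF _ finite_crossing_parameters[OF P, of s "s + 1"]]) auto
  have "s - 1 \<in> ?L" "s + 1 \<in> ?R" using x \<gamma>s by auto
  then have ne: "?L \<noteq> {}" "?R \<noteq> {}" by blast+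
  define p where "p = Max ?L"
  define q where "q = Min ?R"
  have p: "s - 1 \<le> p" "p < s" "\<gamma> p \<in> crossings \<gamma>"
    using Max_in[OF finL ne(1)] by (auto simp: p_def)
  have q: "s < q" "q \<le> s + 1" "\<gamma> q \<in> crossings \<gamma>"
    using Min_in[OF finR ne(2)] by (auto simp: q_def)
  have gapL: "\<gamma> t \<notin> crossings \<gamma>" if "p < t" "t < s" for t
  proof
    assume "\<gamma> t \<in> crossings \<gamma>"
    then have "t \<in> ?L" using that p by auto
    then show False using Max_ge[OF finL] that by (fastforce simp: p_def)
  qed
  have gapR: "\<gamma> t \<notin> crossings \<gamma>" if "s < t" "t < q" for t
  proof
    assume "\<gamma> t \<in> crossings \<gamma>"
    then have "t \<in> ?R" using that q by auto
    then show False using Min_le[OF finR] that by (fastforce simp: q_def)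
  qed
  obtain b t where b: "b \<in> set bs" "p < t" "t < s" "frac b = frac t"
    using base[OF p(2,3) _ gapL] x \<gamma>s by blast
  obtain b' t' where b': "b' \<in> set bs" "s < t'" "t' < q" "frac b' = frac t'"
    using base[OF q(1) _ q(3) gapR] x \<gamma>s by blast
  have x_diff: "entry_parameter \<gamma> b x \<noteq> entry_parameter \<gamma> b' x"
  proof -
    have "first_visit \<gamma> t x s"
      unfolding first_visit_def
    proof (intro conjI allI impI notI)
      fix r assume "t \<le> r \<and> r < s" "\<gamma> r = x"
      then show False using gapL[of r] b x by auto
    qed (use b \<gamma>s in auto)
    then have e1: "entry_parameter \<gamma> t x = frac s" by (rule entry_parameterI)
    obtain v where v: "first_visit \<gamma> t' x v" using P x by (rule first_visit_exists)
    \<comment> \<open>The other pass through \<open>x\<close>, translated into the open interval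
      from \<open>s\<close> to \<open>s + 1\<close>.\<close>
    define r where "r = (if s' < s then s' + 1 else s')"
    have r: "s < r" "r < s + 1" "\<gamma> r = x"
      using s curve_frac(1)[OF imm, of s' 1] by (auto simp: r_def preimages_def)
    \<comment> \<open>Since \<open>t' < q \<le> r\<close>, the first visit \<open>v\<close> from
      \<open>t'\<close> is at most \<open>r\<close>, hence strictly between \<open>s\<close> and
      \<open>s + 1\<close> and not congruent to \<open>s\<close>.\<close>
    have "q \<le> r" using gapR[of r] r x by force
    moreover have "r < v \<Longrightarrow> t' \<le> r \<Longrightarrow> \<gamma> r \<noteq> x" using v by (simp add: first_visit_def)
    ultimately have "\<not> r < v" using r b' by linarith
    then have v': "s < v" "v < s + 1" using v r b' by (auto simp: first_visit_def)
    have "frac v \<noteq> frac s"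
    proof
      assume "frac v = frac s"
      then have "v - s = of_int (\<lfloor>v\<rfloor> - \<lfloor>s\<rfloor>)" by (simp add: frac_def)
      moreover have "0 < v - s" "v - s < 1" using v' by auto
      ultimately show False by (metis of_int_0_less_iff of_int_less_1_iff zless_add1_eq
            add.left_neutral not_less_iff_gr_or_eq)
    qed
    then show ?thesis
      using e1 entry_parameterI[OF v] entry_parameter_frac[OF P x b(4)] entry_parameter_frac[OF P x b'(4)]
      by simp
  qed
  have "entry_parameter \<gamma> b y = entry_parameter \<gamma> b' y"
    if y: "y \<in> crossings \<gamma>" "y \<noteq> x" for y
  proof -
    \<comment> \<open>The only crossing parameter between \<open>t\<close> and \<open>t'\<close> is
      \<open>s\<close>, which belongs to \<open>x\<close>, so moving the start back to
      \<open>t\<close> adds no visit to \<open>y\<close>.\<close>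
    obtain v where v: "first_visit \<gamma> t' y v" using P y(1) by (rule first_visit_exists)
    have "first_visit \<gamma> t y v"
      unfolding first_visit_def
    proof (intro conjI allI impI notI)
      show "t \<le> v" "\<gamma> v = y" using v b b' by (auto simp: first_visit_def)
    next
      fix r assume r: "t \<le> r \<and> r < v" "\<gamma> r = y"
      then have "r < t'" using v by (auto simp: first_visit_def not_le[symmetric])
      then show False
        using gapL[of r] gapR[of r] r y b b' \<gamma>s by (cases r s rule: linorder_cases) auto
    qed
    then show ?thesis
      using entry_parameterI[OF v] entry_parameterI[of \<gamma> t y v]
        entry_parameter_frac[OF P y(1) b(4)] entry_parameter_frac[OF P y(1) b'(4)] by simp
  qed
  then show thesis by (rule that[OF b(1) b'(1) x_diff])
qed

text \<open>On a two-point set, inequality behaves like addition modulo 2. This turns the warping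
  crossings of another diagram into a symmetric difference relative to \<open>D\<close>, which
  serves as \<open>c\<close>.\<close>

lemma card_two_ne_iff:
  assumes "card A = 2" "a \<in> A" "b \<in> A" "c \<in> A"
  shows "a \<noteq> b \<longleftrightarrow> (b \<noteq> c) \<noteq> (a \<noteq> c)"
proof -
  obtain u v where "A = {u, v}" using assms(1) by (auto simp: card_2_iff)
  then show ?thesis using assms(2-4) by auto
qed

section \<open>The warping matrix as a matrix of symmetric differences\<close>

theorem theorem1p2:
  fixes D :: diagram and Ds :: "diagram list" and bs :: "real list"
  assumes "knot_diagram D"
    and "crossing_number D \<ge> 2"
    and "distinct Ds" and "set Ds = diagrams_over (proj D)"
    and "edge_base_points (proj D) bs"
  shows "matrix_rank (warping_matrix_without_signs D Ds bs) = crossing_number D + 1"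
proof -
  define \<gamma> where "\<gamma> = proj D"
  define X where "X = crossings \<gamma>"
  have P: "knot_projection \<gamma>" and over: "over D \<in> (\<Pi>\<^sub>E x \<in> X. preimages \<gamma> x)"
    using assms(1) by (auto simp: knot_diagram_def \<gamma>_def X_def)
  have finX: "finite X" and two: "\<And>x. x \<in> X \<Longrightarrow> card (preimages \<gamma> x) = 2"
    using P by (auto simp: knot_projection_def X_def)
  have bs: "edge_base_points \<gamma> bs" using assms(5) by (simp add: \<gamma>_def)
  \<comment> \<open>The original indices of the rows that are kept; row \<open>i\<close> of the
    submatrix is row \<open>pick R i\<close> of the full matrix.\<close>
  define R where "R = {i. i < length Ds \<and> Ds ! i \<noteq> D}"
  define A where "A = warping_matrix_without_signs D Ds bs"
  have R: "{i. i < dim_row (warping_matrix Ds bs) \<and> i \<in> R} = R"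
    by (auto simp: R_def warping_matrix_def)
  have finR: "finite R" by (simp add: R_def)
  have A: "A \<in> carrier_mat (card R) (length bs)"
    unfolding A_def warping_matrix_without_signs_def R_def[symmetric]
    by (intro carrier_matI) (simp_all only: dim_submatrix R, simp add: warping_matrix_def)
  have pick: "pick R i \<in> R" if "i < card R" for i
    using that by (intro pick_in_set) simp
  define S where "S i = {x. over (Ds ! pick R i) x \<noteq> over D x}" for i
  define T where "T j = {x. entry_parameter \<gamma> (bs ! j) x \<noteq> over D x}" for j
  have diagram: "proj E = \<gamma>" "over E \<in> (\<Pi>\<^sub>E x \<in> X. preimages \<gamma> x)" if "E \<in> set Ds" for E
    using that assms(4) by (auto simp: diagrams_over_def knot_diagram_def \<gamma>_def X_def)
  have "vec_space.rank (card R) A = card X + 1"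
  proof (rule rank_symmetric_difference_matrix[OF A finX, where S = S and T = T])
    show "2 \<le> card X" using assms(2) by (simp add: crossing_number_def X_def \<gamma>_def)
  next
    fix i j assume ij: "i < card R" "j < length bs"
    let ?E = "Ds ! pick R i"
    have E: "?E \<in> set Ds" using pick[OF ij(1)] by (auto simp: R_def)
    have "A $$ (i, j) = warping_matrix Ds bs $$ (pick R i, j)"
      unfolding A_def warping_matrix_without_signs_def R_def[symmetric]
      by (subst submatrix_index) (use ij in \<open>simp_all only: R pick_UNIV, simp_all add: warping_matrix_def\<close>)
    also have "\<dots> = warping_degree ?E (bs ! j)"
      using pick[OF ij(1)] ij by (auto simp: warping_matrix_def R_def)
    also have "{x. warping_crossing ?E (bs ! j) x} = {x \<in> X. (x \<in> S i) \<noteq> (x \<in> T j)}"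
    proof (rule Collect_cong)
      fix x
      have "warping_crossing ?E (bs ! j) x \<longleftrightarrow>
          x \<in> X \<and> entry_parameter \<gamma> (bs ! j) x \<noteq> over ?E x"
        using P diagram[OF E] by (simp add: warping_crossing_iff X_def)
      also have "\<dots> \<longleftrightarrow> x \<in> X \<and> (x \<in> S i) \<noteq> (x \<in> T j)"
      proof (rule conj_cong[OF refl])
        assume x: "x \<in> X"
        have "entry_parameter \<gamma> (bs ! j) x \<in> preimages \<gamma> x"
          using entry_parameter_in_preimages[OF P] x by (simp add: X_def)
        moreover have "over ?E x \<in> preimages \<gamma> x" "over D x \<in> preimages \<gamma> x"
          using diagram(2)[OF E] over x by auto
        ultimately show "entry_parameter \<gamma> (bs ! j) x \<noteq> over ?E x \<longleftrightarrow> (x \<in> S i) \<noteq> (x \<in> T j)"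
          unfolding S_def T_def mem_Collect_eq by (rule card_two_ne_iff[OF two[OF x]])
      qed
      finally show "warping_crossing ?E (bs ! j) x \<longleftrightarrow> x \<in> X \<and> (x \<in> S i) \<noteq> (x \<in> T j)" .
    qed
    then have "warping_degree ?E (bs ! j) = card {x \<in> X. (x \<in> S i) \<noteq> (x \<in> T j)}"
      by (simp add: warping_degree_def)
    finally show "A $$ (i, j) = real (card {x \<in> X. (x \<in> S i) \<noteq> (x \<in> T j)})" .
  next
    fix Y assume Y: "Y \<subseteq> X" "Y \<noteq> {}"
    have "\<exists>s. s \<in> preimages \<gamma> x \<and> s \<noteq> over D x" if "x \<in> X" for x
      using two[OF that] by (metis card_2_iff')
    then obtain other where other: "\<And>x. x \<in> X \<Longrightarrow> other x \<in> preimages \<gamma> x \<and> other x \<noteq> over D x"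
      by metis
    \<comment> \<open>Switching \<open>D\<close> exactly on \<open>Y\<close> stays within the
      \<open>\<Pi>\<^sub>E\<close> condition because \<open>Y \<subseteq> X\<close>, so
      \<open>E\<close> occurs in \<open>Ds\<close>; it is kept because \<open>Y\<close> is
      nonempty.\<close>
    define E where "E = D\<lparr>over := (\<lambda>x. if x \<in> Y then other x else over D x)\<rparr>"
    have "over E \<in> (\<Pi>\<^sub>E x \<in> X. preimages \<gamma> x)"
      using over other Y by (auto simp: E_def PiE_def Pi_def extensional_def)
    moreover have "proj E = \<gamma>" by (simp add: E_def \<gamma>_def)
    ultimately have "E \<in> set Ds"
      using P assms(4) by (simp add: diagrams_over_def knot_diagram_def \<gamma>_def X_def)
    then obtain l where l: "l < length Ds" "Ds ! l = E" by (auto simp: in_set_conv_nth)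
    have diff: "{x. over E x \<noteq> over D x} = Y" using other Y by (auto simp: E_def)
    then have "l \<in> R" using l Y by (auto simp: R_def)
    \<comment> \<open>The number of kept rows above \<open>l\<close> is the position of
      \<open>l\<close> after deletion, inverting \<open>pick\<close>.\<close>
    define i where "i = card {a \<in> R. a < l}"
    have "i < card R"
      unfolding i_def using \<open>l \<in> R\<close> finR by (intro psubset_card_mono) auto
    moreover have "pick R i = l" unfolding i_def using \<open>l \<in> R\<close> by (rule pick_card_in_set)
    ultimately show "\<exists>i<card R. S i \<inter> X = Y" using l diff Y by (auto simp: S_def)
  next
    fix x assume x: "x \<in> X"
    obtain b b' where b: "b \<in> set bs" "b' \<in> set bs"
      and ne: "entry_parameter \<gamma> b x \<noteq> entry_parameter \<gamma> b' x"
      and eq: "\<And>y. y \<in> X \<Longrightarrow> y \<noteq> x \<Longrightarrow> entry_parameter \<gamma> b y = entry_parameter \<gamma> b' y"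
      using base_points_separating[OF P bs] x unfolding X_def by metis
    obtain j j' where j: "j < length bs" "bs ! j = b" "j' < length bs" "bs ! j' = b'"
      using b by (auto simp: in_set_conv_nth)
    have "over D x \<in> preimages \<gamma> x" using over x by auto
    \<comment> \<open>The two entry parameters differ, so exactly one of them equals
      \<open>over D x\<close>. Which one is not known; \<open>j\<close> and \<open>j'\<close> are
      exchanged if necessary at the end.\<close>
    then have "(x \<in> T j) \<noteq> (x \<in> T j')"
      using ne j card_two_ne_iff[OF two[OF x], of "entry_parameter \<gamma> b x" "entry_parameter \<gamma> b' x" "over D x"]
        entry_parameter_in_preimages[OF P] x by (auto simp: T_def X_def)
    moreover have "y \<in> T j \<longleftrightarrow> y \<in> T j'" if "y \<in> X" "y \<noteq> x" for y
      using eq[OF that] j by (simp add: T_def)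
    ultimately show "\<exists>j<length bs. \<exists>j'<length bs. x \<in> T j \<and> x \<notin> T j' \<and>
        (\<forall>y\<in>X. y \<noteq> x \<longrightarrow> (y \<in> T j \<longleftrightarrow> y \<in> T j'))"
      using j by blast
  qed
  then show ?thesis
    using A by (simp add: matrix_rank_def A_def[symmetric] crossing_number_def X_def \<gamma>_def)
qed

end
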